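(* Let $G$ be a split graph, with $V(G)=S\cup T$ a partition of its vertex set such that $S$ is an independent set and $T$ is a clique. Then $\alpha'_g(G)\le\left\lceil\frac{2}{3}|T|\right\rceil$.
   Context: Graphs are finite and simple. A split graph is a graph whose vertex set can be partitioned into a clique and an independent set. The matching game on a graph $G$: two players, Max and Min, alternately add edges of $G$ to a set of chosen edges that must always remain a matching; the game ends when the chosen edges form a maximal matching of $G$ (no further edge can be added). Max wants the final matching to be large, Min wants it to be small. $\alpha'_g(G)$ denotes the size of the final matching under optimal play when Max moves first. *)

theory Defs
  imports Complex_Main "HOL-Library.Ramsey" "HOL-Library.Disjoint_Sets"
begin

text \<open>
  Graphs are given by a vertex set and a set of two-element sets of vertices; cliques and
  independent sets are \<^const>\<open>clique\<close> and \<^const>\<open>indep\<close> of the library.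
\<close>

definition finite_simple_graph :: "'a set \<Rightarrow> 'a set set \<Rightarrow> bool" where
  "finite_simple_graph V E \<longleftrightarrow> finite V \<and> E \<subseteq> [V]\<^bsup>2\<^esup>"

text \<open>Both parts are allowed to be empty.\<close>

definition split_partition :: "'a set \<Rightarrow> 'a set set \<Rightarrow> 'a set \<Rightarrow> 'a set \<Rightarrow> bool" where
  "split_partition V E S T \<longleftrightarrow> S \<union> T = V \<and> S \<inter> T = {} \<and> indep S E \<and> clique T E"

definition is_matching :: "'a set set \<Rightarrow> 'a set set \<Rightarrow> bool" where
  "is_matching E M \<longleftrightarrow> M \<subseteq> E \<and> disjoint M"

definition is_maximal_matching :: "'a set set \<Rightarrow> 'a set set \<Rightarrow> bool" where
  "is_maximal_matching E M \<longleftrightarrow>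
     is_matching E M \<and> (\<forall>M'. is_matching E M' \<and> M \<subseteq> M' \<longrightarrow> M' = M)"

definition legal_moves :: "'a set set \<Rightarrow> 'a set set \<Rightarrow> 'a set set" where
  "legal_moves E M = {e \<in> E - M. is_matching E (insert e M)}"

lemma legal_moves_empty_iff:
  assumes "is_matching E M"
  shows "legal_moves E M = {} \<longleftrightarrow> is_maximal_matching E M"
proof
  assume no_move: "legal_moves E M = {}"
  have "M' = M" if M': "is_matching E M'" "M \<subseteq> M'" for M'
  proof (rule ccontr)
    assume "M' \<noteq> M"
    with M' obtain e where "e \<in> M'" "e \<notin> M" by blast
    with M' have "e \<in> legal_moves E M"
      unfolding legal_moves_def is_matching_def by (auto intro: pairwise_subset)
    with no_move show False by simp
  qed
  with assms show "is_maximal_matching E M" by (simp add: is_maximal_matching_def)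
next
  assume "is_maximal_matching E M"
  then show "legal_moves E M = {}"
    unfolding is_maximal_matching_def legal_moves_def by blast
qed

datatype player = Max_player | Min_player

text \<open>
  The size of the final matching under optimal play from the position in which \<open>M\<close> is the
  set of chosen edges and player \<open>p\<close> is to move. The guard \<^term>\<open>finite E\<close> only serves
  termination: it holds for every finite graph.
\<close>

function game_value :: "'a set set \<Rightarrow> player \<Rightarrow> 'a set set \<Rightarrow> nat" where
  "game_value E p M =
     (if finite E \<and> legal_moves E M \<noteq> {} then
        (case p of
           Max_player \<Rightarrow> Max ((\<lambda>e. game_value E Min_player (insert e M)) ` legal_moves E M)
         | Min_player \<Rightarrow> Min ((\<lambda>e. game_value E Max_player (insert e M)) ` legal_moves E M))
      else card M)"
  by pat_completeness auto
termination
  by (relation "measure (\<lambda>(E, p, M). card (E - M))")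
     (auto simp: legal_moves_def card_gt_0_iff intro!: diff_less)

declare game_value.simps [simp del]

text \<open>The parameter $\alpha'_g(G)$ of the graph with edge set \<open>E\<close>; isolated vertices play no role.\<close>

definition game_matching_number :: "'a set set \<Rightarrow> nat" where
  "game_matching_number E = game_value E Max_player {}"

end

theory Submission
  imports Defs
begin

text \<open>
  Every edge meets the clique \<open>T\<close>, so every move uses at least one free vertex of \<open>T\<close>; Min plays
  inside \<open>T\<close>, using two of them, as long as two are free. So two consecutive moves use at
  least three vertices of \<open>T\<close>.
\<close>

lemma legal_move_disjoint:
  assumes "e \<in> legal_moves E M"
  shows "e \<inter> \<Union>M = {}"
  using assms by (auto simp: legal_moves_def is_matching_def pairwise_insert disjnt_def)

text \<open>Nonemptiness gives \<open>e \<notin> M\<close>: a chosen edge is contained in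
  \<open>\<Union>M\<close>, so it could be disjoint from it only by being empty.\<close>

lemma disjoint_edge_legal:
  assumes "is_matching E M" "e \<in> E" "e \<noteq> {}" "e \<inter> \<Union>M = {}"
  shows "e \<in> legal_moves E M"
  using assms unfolding legal_moves_def is_matching_def pairwise_insert disjnt_def by blast

lemma split_edge_meets_clique:
  assumes "finite_simple_graph V E" "split_partition V E S T" "e \<in> E"
  shows "e \<inter> T \<noteq> {}"
proof
  assume "e \<inter> T = {}"
  moreover have "e \<in> [V]\<^bsup>2\<^esup>"
    using assms unfolding finite_simple_graph_def by blast
  then obtain u v where "e = {u, v}" "u \<noteq> v" "u \<in> V" "v \<in> V"
    by (auto simp: nsets_def card_2_iff)
  ultimately have "u \<in> S" "v \<in> S"
    using assms(2) by (auto simp: split_partition_def)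
  with \<open>e = {u, v}\<close> \<open>u \<noteq> v\<close> assms(2,3) show False
    by (auto simp: split_partition_def indep_def)
qed

text \<open>The bounds are \<open>\<lceil>2t/3\<rceil>\<close> and \<open>\<lceil>(2t - 1)/3\<rceil>\<close>, where \<open>t\<close> is the number of free vertices of \<open>T\<close>.\<close>

lemma game_value_split_le:
  assumes G: "finite_simple_graph V E" and split: "split_partition V E S T"
    and "is_matching E M"
  shows "game_value E p M \<le> card M +
    (case p of Max_player \<Rightarrow> (2 * card (T - \<Union>M) + 2) div 3
      | Min_player \<Rightarrow> (2 * card (T - \<Union>M) + 1) div 3)"
  using assms(3)
\<comment> \<open>Every move uses up a free vertex of \<open>T\<close>, so their number serves as
  the induction measure; \<open>p\<close> varies because the turns alternate.\<close>
proof (induction "card (T - \<Union>M)" arbitrary: M p rule: less_induct)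
  case less
  let ?t = "\<lambda>M. card (T - \<Union>M)"
  have fE: "finite E"
    using G by (meson finite_simple_graph_def finite_imp_finite_nsets finite_subset)
  have fT: "finite T"
    using G split by (auto simp: finite_simple_graph_def split_partition_def)
  have fM: "finite M"
    using less.prems fE by (auto simp: is_matching_def intro: finite_subset)
  have move: "is_matching E (insert e M)" "card (insert e M) = Suc (card M)"
    "?t (insert e M) < ?t M" if e: "e \<in> legal_moves E M" for e
  proof -
    show "is_matching E (insert e M)" "card (insert e M) = Suc (card M)"
      using e fM by (auto simp: legal_moves_def)
    have "e \<inter> T \<noteq> {}"
      using split_edge_meets_clique[OF G split] e by (auto simp: legal_moves_def)
    then have "T - \<Union>(insert e M) \<subset> T - \<Union>M"
      using legal_move_disjoint[OF e] by blast
    then show "?t (insert e M) < ?t M"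
      using fT by (simp add: psubset_card_mono)
  qed
  have fL: "finite (legal_moves E M)"
    using fE by (simp add: legal_moves_def)
  show ?case
  proof (cases "legal_moves E M = {}")
    case True
    then show ?thesis by (simp add: game_value.simps)
  next
    case ne: False
    show ?thesis
    proof (cases p)
      case Max_player
      \<comment> \<open>The worst case is a move using just one free vertex of \<open>T\<close>.
        With t = \<open>?t M\<close> \<ge> 1, it gives 1 + (2(t - 1) + 1) div 3 = (2t + 2) div
        3.\<close>
      have "game_value E Min_player (insert e M) \<le> card M + (2 * ?t M + 2) div 3"
        if e: "e \<in> legal_moves E M" for e
        using less.hyps[OF move(3,1), OF e e, of Min_player] move(2,3)[OF e] by simp
      then show ?thesis
        using ne fE fL Max_player by (subst game_value.simps) simp
    next
      case Min_player
      \<comment> \<open>One good move suffices to bound a minimum.\<close>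
      have "\<exists>e \<in> legal_moves E M.
          game_value E Max_player (insert e M) \<le> card M + (2 * ?t M + 1) div 3"
      proof (cases "?t M \<ge> 2")
        case True
        then obtain e where "e \<subseteq> T - \<Union>M" "card e = 2"
          by (meson obtain_subset_with_card_n)
        then obtain u v where e: "e = {u, v}" "u \<noteq> v" "e \<subseteq> T - \<Union>M"
          by (auto simp: card_2_iff)
        then have "e \<in> E"
          using split by (auto simp: split_partition_def clique_def)
        then have legal: "e \<in> legal_moves E M"
          using e by (intro disjoint_edge_legal less.prems) auto
        have "T - \<Union>(insert e M) = (T - \<Union>M) - e" by auto
        then have "?t (insert e M) = ?t M - 2"
          using e by (simp add: card_Diff_subset)
        \<comment> \<open>With t = \<open>?t M\<close>, 1 + (2(t - 2) + 2) div 3 = (2t + 1) div 3;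
          here t \<ge> 2 keeps the subtraction from truncating.\<close>
        then show ?thesis
          using less.hyps[OF move(3,1), OF legal legal, of Max_player] move(2)[OF legal] True
          by (intro bexI[OF _ legal]) simp
      next
        case False
        \<comment> \<open>Min cannot play inside \<open>T\<close> any more, but any move takes the
          last free vertex there, and 1 + 2 div 3 = 1 = (2 * 1 + 1) div 3, so the bound
          survives.\<close>
        from ne obtain e where e: "e \<in> legal_moves E M" by blast
        with False have "?t M = 1" "?t (insert e M) = 0"
          using move(3)[OF e] by linarith+
        then show ?thesis
          using less.hyps[OF move(3,1), OF e e, of Max_player] move(2)[OF e]
          by (intro bexI[OF _ e]) simp
      qed
      then show ?thesis
        using ne fE fL Min_player by (subst game_value.simps) (simp add: Min_le_iff)
    qed
  qed
qed

theorem proposition3p6: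
  fixes V S T :: "'a set" and E :: "'a set set"
  assumes "finite_simple_graph V E"
    and "split_partition V E S T"
  shows "int (game_matching_number E) \<le> \<lceil>2 / 3 * real (card T)\<rceil>"
proof -
  have "is_matching E {}"
    by (simp add: is_matching_def)
  then have "game_matching_number E \<le> (2 * card T + 2) div 3"
    using game_value_split_le[OF assms, of "{}" Max_player]
    by (simp add: game_matching_number_def)
  then have "3 * game_matching_number E \<le> 2 * card T + 2"
    by linarith
  \<comment> \<open>An integer n satisfies n \<le> \<lceil>x\<rceil> exactly when n < x + 1; the
    strictness comes from 2t + 2 < 2t + 3 with t = \<open>card T\<close>.\<close>
  then have "real (game_matching_number E) < 2 / 3 * real (card T) + 1"
    by linarith
  then show ?thesis
    by linarith
qed

end
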